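(* Let $a,b$ be constants. Then in a neighborhood of $x=0$, $$\sum_{n=0}^\infty\binom{2n}{n}(an+b)\frac{x^n}{(1-4x)^n}\sum_{k=0}^n\binom nk^2\binom{n+k}kx^k=\sum_{n=0}^\infty\binom{3n}n\binom{2n}n^2(An+B)\frac{x^{2n}}{(1-4x)^{3n}},$$ where $$A=\frac{4a(1+2x)(1-x)}{3(1-4x+8x^2)\sqrt{1-4x}},\qquad B=\frac{1}{\sqrt{1-4x}}\Bigl(\frac{2ax(1-2x)}{1-4x+8x^2}+b\Bigr).$$
   Context: $\sqrt{1-4x}$ is the principal branch (equal to $1$ at $x=0$). *)

theory Defs
  imports "HOL-Analysis.Analysis"
begin

end

theory Submission
  imports Defs "HOL-Complex_Analysis.Complex_Analysis"
begin

text \<open>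
  Give the summand \<open>C(2n,n) C(n,k)\<^sup>2 C(n+k,k) x\<^sup>k (x/(1-4x))\<^sup>n\<close> of the left-hand side a polynomial
  weight in \<open>n\<close>, \<open>k\<close> and \<open>x\<close>. On the resulting formal power series the operator
  \<open>\<theta> = (1-4x) x d/dx\<close> acts through the weights, and the first-order recurrences of the
  coefficient in \<open>k\<close> and in \<open>n\<close> show that certain telescoping weights have sum 0. Two identities
  between polynomial weights then give everything. First, the series \<open>E\<close> of weight
  \<open>(1-6x) n - 2(1-x) k - 2x\<close> satisfies a third-order equation in \<open>\<theta>\<close> with exponents 0, 0, 1 and is
  \<open>O(x\<^sup>2)\<close>, so it vanishes. Second, modulo \<open>E\<close>, \<open>\<theta>E\<close> and \<open>\<theta>\<^sup>2E\<close> the series \<open>M\<close> of weight 1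
  satisfies the third-order equation of
  \<open>G = (1-4x)\<^bsup>-1/2\<^esup> \<Sum>\<^sub>n C(3n,n) C(2n,n)\<^sup>2 (x\<^sup>2/(1-4x)\<^sup>3)\<^sup>n\<close>, whose exponents are all 0, so
  \<open>M = G\<close>; this is the case \<open>a = 0\<close>. Applying \<open>\<theta>\<close> to \<open>M = G\<close> and eliminating the series of weight
  \<open>k\<close> by means of \<open>E = 0\<close> yields the series of weight \<open>n\<close>.
\<close>

section \<open>Convergence of formal power series\<close>

instance fps :: (ab_group_add) topological_ab_group_add
proof
  fix f g :: "'a fps"
  have "\<forall>\<^sub>F z in nhds f \<times>\<^sub>F nhds g. fps_nth (fst z + snd z) n = fps_nth (f + g) n" for n
  proof -
    have "\<forall>\<^sub>F z in nhds f \<times>\<^sub>F nhds g. fps_nth (fst z) n = fps_nth f n"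
      "\<forall>\<^sub>F z in nhds f \<times>\<^sub>F nhds g. fps_nth (snd z) n = fps_nth g n"
      using filterlim_fst[of "nhds f" "nhds g"] filterlim_snd[of "nhds g" "nhds f"]
      unfolding tendsto_fps_iff by blast+
    then show ?thesis by eventually_elim simp
  qed
  then show "((\<lambda>z. fst z + snd z) \<longlongrightarrow> f + g) (nhds f \<times>\<^sub>F nhds g)"
    by (rule tendsto_fpsI)
next
  fix f :: "'a fps"
  have "\<forall>\<^sub>F g in nhds f. fps_nth g n = fps_nth f n" for n
    using filterlim_ident[of "nhds f"] unfolding tendsto_fps_iff by blast
  then show "(uminus \<longlongrightarrow> - f) (nhds f)"
    by (intro tendsto_fpsI) (simp add: fps_eq_iff)
qed

instance fps :: (ring) topological_semigroup_mult
proof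
  fix f g :: "'a fps"
  have "\<forall>\<^sub>F z in nhds f \<times>\<^sub>F nhds g. fps_nth (fst z * snd z) n = fps_nth (f * g) n" for n
  proof -
    have "\<forall>\<^sub>F z in nhds f \<times>\<^sub>F nhds g. \<forall>m\<in>{..n}. fps_nth (fst z) m = fps_nth f m"
      "\<forall>\<^sub>F z in nhds f \<times>\<^sub>F nhds g. \<forall>m\<in>{..n}. fps_nth (snd z) m = fps_nth g m"
      using filterlim_fst[of "nhds f" "nhds g"] filterlim_snd[of "nhds g" "nhds f"]
      unfolding tendsto_fps_iff by (auto intro!: eventually_ball_finite)
    then show ?thesis by eventually_elim (simp add: fps_mult_nth)
  qed
  then show "((\<lambda>z. fst z * snd z) \<longlongrightarrow> f * g) (nhds f \<times>\<^sub>F nhds g)"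
    by (rule tendsto_fpsI)
qed

lemma tendsto_fps_deriv:
  fixes f :: "'b \<Rightarrow> 'a::ring_1 fps"
  assumes "(f \<longlongrightarrow> g) F"
  shows "((\<lambda>x. fps_deriv (f x)) \<longlongrightarrow> fps_deriv g) F"
proof (rule tendsto_fpsI)
  fix n
  have "\<forall>\<^sub>F x in F. fps_nth (f x) (n + 1) = fps_nth g (n + 1)"
    using assms by (auto simp: tendsto_fps_iff)
  then show "\<forall>\<^sub>F x in F. fps_nth (fps_deriv (f x)) n = fps_nth (fps_deriv g) n"
    by eventually_elim simp
qed

lemma fps_sums_mult:
  fixes f :: "nat \<Rightarrow> 'a::ring fps"
  assumes "f sums s"
  shows "(\<lambda>n. c * f n) sums (c * s)"
  using assms unfolding sums_def sum_distrib_left[symmetric] by (rule tendsto_mult_left)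

lemma fps_sums_deriv:
  fixes f :: "nat \<Rightarrow> 'a::comm_ring_1 fps"
  assumes "f sums s"
  shows "(\<lambda>n. fps_deriv (f n)) sums fps_deriv s"
  using tendsto_fps_deriv[of _ s] assms by (simp add: sums_def flip: fps_deriv_sum)

lemma fps_sumsI:
  fixes f :: "nat \<Rightarrow> 'a::ab_group_add fps"
  assumes "\<And>m n. m < n \<Longrightarrow> fps_nth (f n) m = 0"
  shows "f sums Abs_fps (\<lambda>m. \<Sum>n\<le>m. fps_nth (f n) m)"
  unfolding sums_def
proof (rule tendsto_fpsI)
  fix m
  show "\<forall>\<^sub>F N in sequentially.
    fps_nth (\<Sum>n<N. f n) m = fps_nth (Abs_fps (\<lambda>m. \<Sum>n\<le>m. fps_nth (f n) m)) m"
    using eventually_gt_at_top[of m]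
  proof eventually_elim
    case (elim N)
    then have "(\<Sum>n\<le>m. fps_nth (f n) m) = (\<Sum>n<N. fps_nth (f n) m)"
      using assms by (intro sum.mono_neutral_left) auto
    then show ?case by (simp add: fps_sum_nth)
  qed
qed

lemma
  fixes Y :: "'a::comm_ring_1 fps"
  assumes "fps_nth Y 0 = 0"
  shows fps_sums_mult_power: "(\<lambda>n. P n * Y ^ n) sums (\<Sum>n. P n * Y ^ n)"
    and fps_nth_suminf_mult_power:
      "fps_nth (\<Sum>n. P n * Y ^ n) m = (\<Sum>n\<le>m. fps_nth (P n * Y ^ n) m)"
proof -
  have "fps_nth (P n * Y ^ n) m = 0" if "m < n" for m n
    using startsby_zero_power_prefix[OF assms, of n] that by (simp add: fps_mult_nth)
  then have "(\<lambda>n. P n * Y ^ n) sums Abs_fps (\<lambda>m. \<Sum>n\<le>m. fps_nth (P n * Y ^ n) m)"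
    by (rule fps_sumsI)
  then show "(\<lambda>n. P n * Y ^ n) sums (\<Sum>n. P n * Y ^ n)"
    and "fps_nth (\<Sum>n. P n * Y ^ n) m = (\<Sum>n\<le>m. fps_nth (P n * Y ^ n) m)"
    by (simp_all add: sums_iff)
qed

lemma fps_suminf_mult_power_add:
  fixes Y :: "'a::comm_ring_1 fps"
  assumes "fps_nth Y 0 = 0"
  shows "(\<Sum>n. P n * Y ^ n) + (\<Sum>n. Q n * Y ^ n) = (\<Sum>n. (P n + Q n) * Y ^ n)"
  unfolding distrib_right by (intro sums_unique sums_add fps_sums_mult_power assms)

lemma fps_suminf_mult_power_cmult:
  fixes Y :: "'a::comm_ring_1 fps"
  assumes "fps_nth Y 0 = 0"
  shows "c * (\<Sum>n. P n * Y ^ n) = (\<Sum>n. c * P n * Y ^ n)"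
  unfolding mult.assoc by (intro sums_unique fps_sums_mult fps_sums_mult_power assms)

lemma fps_suminf_mult_power_Suc:
  fixes Y :: "'a::comm_ring_1 fps"
  assumes "fps_nth Y 0 = 0" and "P 0 = 0"
  shows "(\<Sum>n. P n * Y ^ n) = Y * (\<Sum>n. P (Suc n) * Y ^ n)"
proof -
  have "(\<lambda>n. P (Suc n) * Y ^ Suc n) sums (Y * (\<Sum>n. P (Suc n) * Y ^ n))"
    using fps_sums_mult[OF fps_sums_mult_power[OF assms(1), of "\<lambda>n. P (Suc n)"], of Y]
    by (simp only: power_Suc mult.left_commute)
  then have "(\<lambda>n. P n * Y ^ n) sums (Y * (\<Sum>n. P (Suc n) * Y ^ n) + P 0 * Y ^ 0)"
    by (rule sums_Suc)
  then show ?thesis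
    using \<open>P 0 = 0\<close> by (simp add: sums_iff)
qed

text \<open>Termwise expansion needs domination on a common neighbourhood: formal and locally uniform
  convergence are independent of each other.\<close>

lemma has_fps_expansion_suminf:
  fixes f :: "nat \<Rightarrow> complex \<Rightarrow> complex"
  assumes A: "open A" "0 \<in> A"
    and holomorphic: "\<And>n. f n holomorphic_on A"
    and bound: "\<And>n x. x \<in> A \<Longrightarrow> norm (f n x) \<le> M n" and "summable M"
    and expansion: "\<And>n. f n has_fps_expansion F n" and sums: "F sums S"
  shows "(\<lambda>x. \<Sum>n. f n x) has_fps_expansion S"
proof -
  define g where "g = (\<lambda>x. \<Sum>n. f n x)"
  have limit: "uniform_limit A (\<lambda>N x. \<Sum>n<N. f n x) g sequentially"
    unfolding g_def using bound \<open>summable M\<close> by (rule Weierstrass_m_test)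
  have partial_holomorphic: "(\<lambda>x. \<Sum>n<N. f n x) holomorphic_on A" for N
    by (intro holomorphic_intros holomorphic)
  have "g holomorphic_on A"
    using \<open>open A\<close> partial_holomorphic
  proof (rule holomorphic_uniform_sequence)
    fix x assume "x \<in> A"
    then show "\<exists>d>0. cball x d \<subseteq> A \<and> uniform_limit (cball x d) (\<lambda>N x. \<Sum>n<N. f n x) g sequentially"
      using \<open>open A\<close> limit by (meson open_contains_cball uniform_limit_on_subset)
  qed
  then have g: "g has_fps_expansion fps_expansion g 0"
    using A by blast
  have "fps_expansion g 0 = S"
  proof (rule uniform_limit_imp_fps_expansion_eq[OF _ limit _ g _ A])
    show "(\<lambda>N. \<Sum>n<N. F n) \<longlonglongrightarrow> S"
      using sums by (simp add: sums_def)
    show "\<forall>\<^sub>F N in sequentially. (\<lambda>x. \<Sum>n<N. f n x) has_fps_expansion (\<Sum>n<N. F n)"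
      by (intro always_eventually allI has_fps_expansion_sum expansion)
  qed (use partial_holomorphic in auto)
  then show ?thesis using g by (simp add: g_def)
qed

lemma
  fixes p :: "nat \<Rightarrow> complex \<Rightarrow> complex"
  assumes A: "open A" "0 \<in> A"
    and holomorphic: "\<And>n. p n holomorphic_on A" "y holomorphic_on A"
    and bound: "\<And>n x. x \<in> A \<Longrightarrow> norm (p n x) \<le> C ^ n"
    and expansion: "\<And>n. p n has_fps_expansion P n" "y has_fps_expansion Y"
    and Y: "fps_nth Y 0 = 0"
  shows has_fps_expansion_suminf_mult_power:
      "(\<lambda>x. \<Sum>n. p n x * y x ^ n) has_fps_expansion (\<Sum>n. P n * Y ^ n)" (is ?expansion)
    and eventually_summable_mult_power:
      "\<forall>\<^sub>F x in nhds 0. summable (\<lambda>n. p n x * y x ^ n)" (is ?summable)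
proof -
  have "0 \<le> C"
    using order_trans[OF norm_ge_zero bound[of 0 1]] A by simp
  define B where "B = A \<inter> y -` ball 0 (1 / (2 * (C + 1)))"
  have "y 0 = 0"
    using has_fps_expansion_imp_0_eq_fps_nth_0[OF expansion(2)] Y by simp
  then have B: "open B" "0 \<in> B"
    using A holomorphic(2) \<open>0 \<le> C\<close>
    by (auto simp: B_def intro: continuous_open_preimage holomorphic_on_imp_continuous_on)
  have term_bound: "norm (p n x * y x ^ n) \<le> (1 / 2) ^ n" if "x \<in> B" for n x
  proof -
    have "norm (p n x * y x ^ n) \<le> C ^ n * (1 / (2 * (C + 1))) ^ n"
      using that bound[of x n] \<open>0 \<le> C\<close> unfolding norm_mult norm_power B_def
      by (intro mult_mono power_mono) auto
    also have "\<dots> = (C / (2 * (C + 1))) ^ n"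
      by (simp flip: power_mult_distrib)
    also have "\<dots> \<le> (1 / 2) ^ n"
      using \<open>0 \<le> C\<close> by (intro power_mono) (auto simp: field_simps)
    finally show ?thesis .
  qed
  have geometric: "summable (\<lambda>n. (1 / 2 :: real) ^ n)"
    by (simp add: summable_geometric)
  show ?expansion
    using B(1,2) _ term_bound geometric _ fps_sums_mult_power[OF Y]
  proof (rule has_fps_expansion_suminf)
    have "B \<subseteq> A" by (auto simp: B_def)
    then show "(\<lambda>x. p n x * y x ^ n) holomorphic_on B" for n
      by (intro holomorphic_intros holomorphic_on_subset[OF holomorphic(1)]
          holomorphic_on_subset[OF holomorphic(2)])
    show "(\<lambda>x. p n x * y x ^ n) has_fps_expansion P n * Y ^ n" for n
      by (intro fps_expansion_intros expansion)
  qed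
  show ?summable
    using eventually_nhds_in_open[OF B]
    by eventually_elim (rule summable_comparison_test'[OF geometric term_bound])
qed

lemma has_fps_expansion_eventually_eq:
  assumes "f has_fps_expansion F" "g has_fps_expansion F"
  shows "\<forall>\<^sub>F x in nhds 0. f x = g x"
proof -
  have "\<forall>\<^sub>F x in nhds 0. eval_fps F x = f x" "\<forall>\<^sub>F x in nhds 0. eval_fps F x = g x"
    using assms by (simp_all add: has_fps_expansion_def)
  then show ?thesis by eventually_elim simp
qed

section \<open>Linear differential equations\<close>

text \<open>The factor \<open>1 - 4x\<close> makes \<open>x/(1-4x)\<close> and \<open>x\<^sup>2/(1-4x)\<^sup>3\<close> eigenvectors with polynomial
  eigenvalues.\<close>

definition theta :: "'a::comm_ring_1 fps \<Rightarrow> 'a fps" where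
  "theta f = (1 - 4 * fps_X) * fps_X * fps_deriv f"

lemma theta_simps [simp]:
  "theta 0 = 0" "theta 1 = 0" "theta (numeral k) = 0" "theta (of_nat n) = 0"
  "theta fps_X = (1 - 4 * fps_X) * fps_X"
  "theta (- f) = - theta f" "theta (f + g) = theta f + theta g" "theta (f - g) = theta f - theta g"
  "theta (f * g) = theta f * g + f * theta g"
  by (simp_all add: theta_def algebra_simps)

lemma theta_sum [simp]: "theta (\<Sum>i\<in>A. f i) = (\<Sum>i\<in>A. theta (f i))"
  by (simp add: theta_def fps_deriv_sum sum_distrib_left)

lemma theta_power_eigen:
  assumes "theta f = c * f"
  shows "theta (f ^ n) = of_nat n * c * f ^ n"
  using assms by (induction n) (simp_all add: algebra_simps)

lemma theta_X_power [simp]: "theta (fps_X ^ n) = of_nat n * (1 - 4 * fps_X) * fps_X ^ n"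
  by (rule theta_power_eigen) simp

lemma theta_sums: "f sums s \<Longrightarrow> (\<lambda>n. theta (f n)) sums theta s"
  unfolding theta_def by (intro fps_sums_mult fps_sums_deriv)

lemma theta_suminf_mult_power:
  fixes Y :: "'a::comm_ring_1 fps"
  assumes Y: "fps_nth Y 0 = 0" "theta Y = c * Y"
  shows "theta (\<Sum>n. P n * Y ^ n) = (\<Sum>n. (theta (P n) + of_nat n * c * P n) * Y ^ n)"
proof -
  have "theta (P n * Y ^ n) = (theta (P n) + of_nat n * c * P n) * Y ^ n" for n
    by (simp add: theta_power_eigen[OF Y(2)] algebra_simps)
  then show ?thesis
    using sums_unique[OF theta_sums[OF fps_sums_mult_power[OF Y(1), of P]]] by simp
qed

lemma theta_nth_lowest:
  assumes "\<forall>m<n. fps_nth f m = 0"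
  shows "\<forall>m<n. fps_nth (theta f) m = 0" "fps_nth (theta f) n = of_nat n * fps_nth f n"
proof -
  have "theta f = fps_X * fps_deriv f - fps_const 4 * (fps_X * (fps_X * fps_deriv f))"
    by (simp add: theta_def algebra_simps numeral_fps_const)
  then have nth: "fps_nth (theta f) m = of_nat m * fps_nth f m -
      4 * (if m = 0 then 0 else of_nat (m - 1) * fps_nth f (m - 1))" for m
    by (cases m; cases "m - 1") (simp_all add: fps_X_mult_nth)
  show "\<forall>m<n. fps_nth (theta f) m = 0" "fps_nth (theta f) n = of_nat n * fps_nth f n"
    using assms by (auto simp: nth)
qed

fun theta_op :: "'a::comm_ring_1 fps list \<Rightarrow> 'a fps \<Rightarrow> 'a fps" where
  "theta_op [] f = 0"
| "theta_op (p # ps) f = p * f + theta_op ps (theta f)"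

lemma theta_op_diff: "theta_op ps (f - g) = theta_op ps f - theta_op ps g"
  by (induction ps arbitrary: f g) (simp_all add: algebra_simps)

lemma theta_op_0 [simp]: "theta_op ps 0 = 0"
  by (induction ps) simp_all

lemma theta_op_nth_lowest:
  assumes "\<forall>m<n. fps_nth f m = 0"
  shows "fps_nth (theta_op ps f) n = horner_sum (\<lambda>p. fps_nth p 0) (of_nat n) ps * fps_nth f n"
  using assms
proof (induction ps arbitrary: f)
  case (Cons p ps)
  have "fps_nth (p * f) n = (\<Sum>i\<in>{0}. fps_nth p i * fps_nth f (n - i))"
    unfolding fps_mult_nth using Cons.prems by (intro sum.mono_neutral_right) auto
  then show ?case
    using Cons.IH[OF theta_nth_lowest(1)[OF Cons.prems]] theta_nth_lowest(2)[OF Cons.prems]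
    by (simp add: algebra_simps)
qed simp

lemma theta_op_eq_0_imp_eq_0:
  fixes f :: "'a::idom fps"
  assumes "theta_op ps f = 0"
    and indicial: "\<And>n. n \<ge> r \<Longrightarrow> horner_sum (\<lambda>p. fps_nth p 0) (of_nat n) ps \<noteq> 0"
    and initial: "\<And>n. n < r \<Longrightarrow> fps_nth f n = 0"
  shows "f = 0"
proof (rule fps_ext)
  fix n
  show "fps_nth f n = fps_nth 0 n"
  proof (induction n rule: less_induct)
    case (less n)
    then have "horner_sum (\<lambda>p. fps_nth p 0) (of_nat n) ps * fps_nth f n = 0"
      using theta_op_nth_lowest[of n f ps] \<open>theta_op ps f = 0\<close> by simp
    then show ?case
      using indicial[of n] initial[of n] by (cases "n < r") auto
  qed
qed

lemma one_minus_4X_mult_inverse: "(1 - 4 * fps_X) * inverse (1 - 4 * fps_X) = (1 :: 'a::field fps)"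
  by (simp add: inverse_mult_eq_1')

lemma theta_inverse_one_minus_4X:
  "theta (inverse (1 - 4 * fps_X)) = 4 * fps_X * inverse (1 - 4 * fps_X :: 'a::field fps)"
proof -
  let ?i = "inverse (1 - 4 * fps_X) :: 'a fps"
  have "theta ?i = ((1 - 4 * fps_X) * ?i) * (4 * fps_X * ?i)"
    by (simp add: theta_def fps_inverse_deriv power2_eq_square mult_ac)
  then show ?thesis
    by (simp only: one_minus_4X_mult_inverse mult_1)
qed

section \<open>The weighted series of the left-hand side\<close>

lemma central_binomial_Suc:
  "(2 * Suc n choose Suc n) * Suc n = 2 * (2 * n + 1) * (2 * n choose n)"
proof -
  have "(2 * Suc n choose Suc n) * Suc n = 2 * (Suc n * (2 * n + 1 choose n))"
    using Suc_times_binomial_eq[of "2 * n + 1" n] by simp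
  also have "Suc n * (2 * n + 1 choose n) = (2 * n + 1) * (2 * n choose n)"
    using binomial_absorb_comp[of "2 * n + 1" n] by simp
  finally show ?thesis by simp
qed

text \<open>Without the central binomial coefficient, these sum over \<open>k\<close> to the Apery numbers for \<open>\<zeta>(2)\<close>.\<close>

definition apery_coeff :: "nat \<Rightarrow> nat \<Rightarrow> nat" where
  "apery_coeff n k = (2 * n choose n) * (n choose k)\<^sup>2 * (n + k choose k)"

lemma apery_coeff_Suc_right:
  "apery_coeff n (Suc k) * Suc k ^ 3 = apery_coeff n k * ((n + k + 1) * (n - k)\<^sup>2)"
proof -
  have lower: "(n choose Suc k) * Suc k = (n choose k) * (n - k)"
    by (metis binomial_absorption binomial_absorb_comp mult.commute)
  have diagonal: "(n + Suc k choose Suc k) * Suc k = Suc (n + k) * (n + k choose k)"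
    by (metis Suc_times_binomial_eq add_Suc_right)
  have "apery_coeff n (Suc k) * Suc k ^ 3 =
      (2 * n choose n) * ((n choose Suc k) * Suc k)\<^sup>2 * ((n + Suc k choose Suc k) * Suc k)"
    by (simp only: apery_coeff_def power2_eq_square power3_eq_cube mult_ac)
  also have "\<dots> = apery_coeff n k * ((n + k + 1) * (n - k)\<^sup>2)"
    unfolding lower diagonal apery_coeff_def power2_eq_square
    by (simp only: mult_ac Suc_eq_plus1 add_ac)
  finally show ?thesis .
qed

lemma apery_coeff_Suc_left:
  "apery_coeff (Suc n) k * (Suc n - k)\<^sup>2 = apery_coeff n k * (2 * ((2 * n + 1) * (n + 1 + k)))"
proof -
  have upper: "(Suc n choose k) * (Suc n - k) = Suc n * (n choose k)"
    using binomial_absorb_comp[of "Suc n" k] by (simp add: mult.commute)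
  have diagonal: "(Suc n + k choose k) * Suc n = (Suc n + k) * (n + k choose k)"
    using binomial_absorb_comp[of "Suc n + k" k] by (simp add: mult.commute)
  have "(apery_coeff (Suc n) k * (Suc n - k)\<^sup>2) * (Suc n)\<^sup>2 =
      ((2 * Suc n choose Suc n) * Suc n) * ((Suc n choose k) * (Suc n - k))\<^sup>2 *
      ((Suc n + k choose k) * Suc n)"
    by (simp only: apery_coeff_def power2_eq_square mult_ac)
  also have "\<dots> = (apery_coeff n k * (2 * ((2 * n + 1) * (n + 1 + k)))) * (Suc n)\<^sup>2"
    unfolding upper diagonal central_binomial_Suc apery_coeff_def power2_eq_square
    by (simp only: mult_ac Suc_eq_plus1 add_ac)
  finally show ?thesis by simp
qed

definition apery_poly :: "(nat \<Rightarrow> nat \<Rightarrow> complex fps) \<Rightarrow> nat \<Rightarrow> complex fps" where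
  "apery_poly w n = (\<Sum>k\<le>n. of_nat (apery_coeff n k) * w n k * fps_X ^ k)"

definition apery_series :: "(nat \<Rightarrow> nat \<Rightarrow> complex fps) \<Rightarrow> complex fps" where
  "apery_series w = (\<Sum>n. apery_poly w n * (fps_X * inverse (1 - 4 * fps_X)) ^ n)"

lemma apery_series_nth_0: "fps_nth (apery_series w) 0 = fps_nth (w 0 0) 0"
  by (simp add: apery_series_def fps_nth_suminf_mult_power apery_poly_def apery_coeff_def)

lemma apery_series_nth_Suc_0:
  "fps_nth (apery_series w) (Suc 0) = fps_nth (w 0 0) (Suc 0) + 2 * fps_nth (w (Suc 0) 0) 0"
  by (simp add: apery_series_def fps_nth_suminf_mult_power apery_poly_def apery_coeff_def
      numeral_fps_const mult.assoc)

lemma apery_series_add: "apery_series v + apery_series w = apery_series (\<lambda>n k. v n k + w n k)"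
  by (simp add: apery_series_def fps_suminf_mult_power_add apery_poly_def sum.distrib distrib_left
      distrib_right)

lemma apery_series_diff: "apery_series v - apery_series w = apery_series (\<lambda>n k. v n k - w n k)"
  using apery_series_add[of "\<lambda>n k. v n k - w n k" w] by (simp add: diff_eq_eq)

lemma apery_series_mult: "c * apery_series w = apery_series (\<lambda>n k. c * w n k)"
proof -
  have "c * apery_poly w n = apery_poly (\<lambda>n k. c * w n k) n" for n
    by (simp add: apery_poly_def sum_distrib_left mult_ac)
  then show ?thesis
    by (simp add: apery_series_def fps_suminf_mult_power_cmult)
qed

lemma theta_apery_series:
  "theta (apery_series w) =
    apery_series (\<lambda>n k. theta (w n k) + (of_nat n + of_nat k * (1 - 4 * fps_X)) * w n k)"
proof -
  define y :: "complex fps" where "y = fps_X * inverse (1 - 4 * fps_X)"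
  have y: "fps_nth y 0 = 0" "theta y = 1 * y"
    unfolding y_def theta_simps theta_inverse_one_minus_4X by (simp, algebra)
  have "theta (apery_poly w n) + of_nat n * 1 * apery_poly w n = apery_poly
      (\<lambda>n k. theta (w n k) + (of_nat n + of_nat k * (1 - 4 * fps_X)) * w n k) n" for n
    unfolding apery_poly_def theta_sum sum_distrib_left sum.distrib[symmetric]
    by (intro sum.cong) (simp_all add: algebra_simps)
  then show ?thesis
    by (simp add: apery_series_def theta_suminf_mult_power[OF y] flip: y_def)
qed

lemma of_nat_apery_coeff_Suc_right:
  assumes "k \<le> n"
  shows "of_nat (apery_coeff n (Suc k)) * of_nat (Suc k) ^ 3 =
    of_nat (apery_coeff n k) *
      ((of_nat n + of_nat k + 1) * (of_nat n - of_nat k :: 'a::comm_ring_1)\<^sup>2)"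
  using arg_cong[OF apery_coeff_Suc_right[of n k], of "of_nat :: nat \<Rightarrow> 'a"] assms
  by (simp only: of_nat_mult of_nat_add of_nat_power of_nat_1 of_nat_diff)

lemma of_nat_apery_coeff_Suc_left:
  assumes "k \<le> n"
  shows "of_nat (apery_coeff (Suc n) k) * (of_nat (Suc n) - of_nat k)\<^sup>2 =
    of_nat (apery_coeff n k) *
      (2 * ((2 * of_nat n + 1) * (of_nat n + 1 + of_nat k :: 'a::comm_ring_1)))"
  using arg_cong[OF apery_coeff_Suc_left[of n k], of "of_nat :: nat \<Rightarrow> 'a"]
    of_nat_diff[OF le_SucI[OF assms], where 'a = 'a]
  by (simp only: of_nat_mult of_nat_add of_nat_power of_nat_1 of_nat_numeral)

lemma apery_poly_Suc_right:
  "apery_poly (\<lambda>n k. u n k * of_nat k ^ 3) n = apery_poly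
    (\<lambda>n k. fps_X * u n (Suc k) * ((of_nat n + of_nat k + 1) * (of_nat n - of_nat k)\<^sup>2)) n"
proof -
  let ?f = "\<lambda>k. of_nat (apery_coeff n k) * (u n k * of_nat k ^ 3) * fps_X ^ k"
  let ?g = "\<lambda>k. of_nat (apery_coeff n k) *
    (fps_X * u n (Suc k) * ((of_nat n + of_nat k + 1) * (of_nat n - of_nat k)\<^sup>2)) * fps_X ^ k"
  have shift: "?f (Suc k) = ?g k" if "k \<in> {..n}" for k
  proof -
    have "?f (Suc k) =
        u n (Suc k) * (of_nat (apery_coeff n (Suc k)) * of_nat (Suc k) ^ 3) * fps_X ^ Suc k"
      by (simp only: mult_ac)
    also have "\<dots> = ?g k"
      using that of_nat_apery_coeff_Suc_right[of k n, where 'a = "complex fps"]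
      by (simp only: atMost_iff power_Suc mult_ac)
    finally show ?thesis .
  qed
  have "(\<Sum>k\<le>n. ?f k) = (\<Sum>k\<le>Suc n. ?f k)"
    by (simp add: apery_coeff_def)
  also have "\<dots> = ?f 0 + (\<Sum>k\<le>n. ?f (Suc k))"
    by (rule sum.atMost_Suc_shift)
  also have "(\<Sum>k\<le>n. ?f (Suc k)) = (\<Sum>k\<le>n. ?g k)"
    using shift by (rule sum.cong[OF refl])
  finally show ?thesis
    by (simp add: apery_poly_def)
qed

lemma apery_poly_Suc_left:
  "apery_poly (\<lambda>n k. v n k * (of_nat n - of_nat k)\<^sup>2) (Suc n) =
    apery_poly (\<lambda>n k. 2 * v (Suc n) k * ((2 * of_nat n + 1) * (of_nat n + 1 + of_nat k))) n"
proof -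
  let ?f = "\<lambda>k. of_nat (apery_coeff (Suc n) k) *
    (v (Suc n) k * (of_nat (Suc n) - of_nat k)\<^sup>2) * fps_X ^ k"
  let ?g = "\<lambda>k. of_nat (apery_coeff n k) *
    (2 * v (Suc n) k * ((2 * of_nat n + 1) * (of_nat n + 1 + of_nat k))) * fps_X ^ k"
  have shift: "?f k = ?g k" if "k \<in> {..n}" for k
  proof -
    have "?f k =
        v (Suc n) k * (of_nat (apery_coeff (Suc n) k) * (of_nat (Suc n) - of_nat k)\<^sup>2) * fps_X ^ k"
      by (simp only: mult_ac)
    also have "\<dots> = ?g k"
      using that of_nat_apery_coeff_Suc_left[of k n, where 'a = "complex fps"]
      by (simp only: atMost_iff mult_ac)
    finally show ?thesis .
  qed
  have "(\<Sum>k\<le>Suc n. ?f k) = (\<Sum>k\<le>n. ?f k)"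
    by simp
  also have "\<dots> = (\<Sum>k\<le>n. ?g k)"
    using shift by (rule sum.cong[OF refl])
  finally show ?thesis
    by (simp add: apery_poly_def)
qed

lemma apery_series_Suc_right:
  "apery_series (\<lambda>n k. u n k * of_nat k ^ 3) = apery_series
    (\<lambda>n k. fps_X * u n (Suc k) * ((of_nat n + of_nat k + 1) * (of_nat n - of_nat k)\<^sup>2))"
  by (simp only: apery_series_def apery_poly_Suc_right)

lemma apery_series_Suc_left:
  "(1 - 4 * fps_X) * apery_series (\<lambda>n k. v n k * (of_nat n - of_nat k)\<^sup>2) = apery_series
    (\<lambda>n k. fps_X * (2 * v (Suc n) k * ((2 * of_nat n + 1) * (of_nat n + 1 + of_nat k))))"
    (is "_ * apery_series ?f = apery_series (\<lambda>n k. fps_X * ?g n k)")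
proof -
  let ?i = "inverse (1 - 4 * fps_X) :: complex fps"
  have "apery_series ?f = fps_X * ?i * (\<Sum>n. apery_poly ?f (Suc n) * (fps_X * ?i) ^ n)"
    unfolding apery_series_def by (rule fps_suminf_mult_power_Suc) (simp_all add: apery_poly_def)
  then have "apery_series ?f = fps_X * ?i * apery_series ?g"
    by (simp only: apery_poly_Suc_left apery_series_def)
  then have "(1 - 4 * fps_X) * apery_series ?f = ((1 - 4 * fps_X) * ?i) * (fps_X * apery_series ?g)"
    by (simp only: mult_ac)
  then show ?thesis
    by (simp only: one_minus_4X_mult_inverse mult_1 apery_series_mult[of fps_X])
qed

definition telescoper ::
  "(nat \<Rightarrow> nat \<Rightarrow> complex fps) \<Rightarrow> (nat \<Rightarrow> nat \<Rightarrow> complex fps) \<Rightarrow> nat \<Rightarrow> nat \<Rightarrow> complex fps" where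
  "telescoper u v n k =
    u n k * of_nat k ^ 3 -
      fps_X * u n (Suc k) * ((of_nat n + of_nat k + 1) * (of_nat n - of_nat k)\<^sup>2) +
    ((1 - 4 * fps_X) * (v n k * (of_nat n - of_nat k)\<^sup>2) -
      fps_X * (2 * v (Suc n) k * ((2 * of_nat n + 1) * (of_nat n + 1 + of_nat k))))"

lemma apery_series_telescoper: "apery_series (telescoper u v) = 0"
  unfolding telescoper_def[abs_def] apery_series_add[symmetric] apery_series_diff[symmetric]
    apery_series_mult[symmetric, of "1 - 4 * fps_X"] apery_series_Suc_right apery_series_Suc_left
  by simp

definition moment_relation :: "nat \<Rightarrow> nat \<Rightarrow> complex fps" where
  "moment_relation n k =
    (1 - 6 * fps_X) * of_nat n - 2 * (1 - fps_X) * of_nat k - 2 * fps_X"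

text \<open>Here and below, the coefficients of \<open>u\<close> and \<open>v\<close> come from an ansatz polynomial in \<open>n\<close> and \<open>k\<close>,
  solved as a linear system over the rational functions in \<open>x\<close>.\<close>

lemma theta_op_moment_relation:
  "theta_op [8 * fps_X\<^sup>2, 2 * fps_X + 24 * fps_X\<^sup>2, 14 * fps_X - 1, 1]
    (apery_series moment_relation) = 0"
    (is "theta_op ?ps _ = 0")
proof -
  define u :: "nat \<Rightarrow> nat \<Rightarrow> complex fps" where "u n k =
    (4 - 32 * fps_X + 64 * fps_X ^ 2 - 32 * fps_X ^ 3) +
    (- 4 + 16 * fps_X + 16 * fps_X ^ 2 - 128 * fps_X ^ 3) * of_nat n +
    (- 4 + 48 * fps_X - 176 * fps_X ^ 2 + 192 * fps_X ^ 3) * of_nat k" for n k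
  define v :: "nat \<Rightarrow> nat \<Rightarrow> complex fps" where "v n k =
    (8 * fps_X ^ 2 - 16 * fps_X ^ 3) +
    (- 1 + 2 * fps_X + 8 * fps_X ^ 2 - 32 * fps_X ^ 3) * of_nat n +
    (- 2 + 6 * fps_X + 24 * fps_X ^ 2 - 32 * fps_X ^ 3) * of_nat k +
    (1 - 2 * fps_X + 16 * fps_X ^ 3) * of_nat n ^ 2 +
    (3 - 12 * fps_X + 16 * fps_X ^ 2 - 32 * fps_X ^ 3) * (of_nat n * of_nat k) +
    (2 - 18 * fps_X + 32 * fps_X ^ 2 - 16 * fps_X ^ 3) * of_nat k ^ 2" for n k
  have "theta_op ?ps (apery_series moment_relation) = apery_series (telescoper u v)"
    unfolding theta_op.simps theta_apery_series apery_series_mult apery_series_add add_0_right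
  proof (intro arg_cong[of _ _ apery_series] ext, goal_cases)
    case (1 n k)
    show ?case
      unfolding moment_relation_def telescoper_def u_def v_def theta_simps theta_X_power of_nat_Suc
        of_nat_numeral
      by algebra
  qed
  then show ?thesis
    by (simp only: apery_series_telescoper)
qed

lemma apery_series_moment_relation: "apery_series moment_relation = 0"
  using theta_op_moment_relation
proof (rule theta_op_eq_0_imp_eq_0[where r = 2])
  fix n :: nat
  show "fps_nth (apery_series moment_relation) n = 0" if "n < 2"
    using that
    by (auto simp: less_2_cases_iff apery_series_nth_0 apery_series_nth_Suc_0 moment_relation_def
        numeral_fps_const)
  assume "2 \<le> n"
  then have "of_nat n ^ 2 * (of_nat n - 1) \<noteq> (0 :: complex)"
    by simp
  then show "horner_sum (\<lambda>p. fps_nth p 0) (of_nat n)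
      [8 * fps_X\<^sup>2, 2 * fps_X + 24 * fps_X\<^sup>2, 14 * fps_X - 1, 1 :: complex fps] \<noteq> 0"
    by (simp add: algebra_simps power2_eq_square)
qed

text \<open>The hypergeometric equation of \<open>\<Sum> hyp_coeff n t\<^sup>n\<close>, pulled back along \<open>t = x\<^sup>2/(1-4x)\<^sup>3\<close> and
  conjugated by \<open>(1-4x)\<^bsup>-1/2\<^esup>\<close>.\<close>

definition ode_coeffs :: "complex fps list" where
  "ode_coeffs =
    [- 2 * fps_X * (1 + 6 * fps_X + 48 * fps_X\<^sup>2 - 64 * fps_X ^ 3),
     - 4 * fps_X * (2 + 21 * fps_X + 16 * fps_X\<^sup>2),
     - 12 * fps_X * (1 + 8 * fps_X),
     1 - 16 * fps_X]"

lemma theta_op_ode_apery_series: "theta_op ode_coeffs (apery_series (\<lambda>n k. 1)) = 0"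
proof -
  define u :: "nat \<Rightarrow> nat \<Rightarrow> complex fps" where "u n k =
    - 12 + 144 * fps_X - 672 * fps_X ^ 2 + 1536 * fps_X ^ 3 - 1536 * fps_X ^ 4" for n k
  define v :: "nat \<Rightarrow> nat \<Rightarrow> complex fps" where "v n k =
    (- 6 * fps_X + 42 * fps_X ^ 2 - 24 * fps_X ^ 3 - 48 * fps_X ^ 4) +
    (3 - 21 * fps_X + 84 * fps_X ^ 2 - 168 * fps_X ^ 3 + 192 * fps_X ^ 4) * of_nat n +
    (6 - 45 * fps_X + 120 * fps_X ^ 2 - 120 * fps_X ^ 3 - 96 * fps_X ^ 4) * of_nat k" for n k
  define cs :: "complex fps list" where "cs =
    [- 6 * fps_X + 32 * fps_X ^ 2 - 64 * fps_X ^ 3 - 16 * fps_X ^ 4,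
     - 18 * fps_X + 92 * fps_X ^ 2 - 176 * fps_X ^ 3,
     - 3 + 16 * fps_X - 28 * fps_X ^ 2]"
  have "fps_X * theta_op ode_coeffs (apery_series (\<lambda>n k. 1)) -
      theta_op cs (apery_series moment_relation) =
      apery_series (telescoper u v)"
    unfolding ode_coeffs_def cs_def theta_op.simps theta_apery_series apery_series_mult
      apery_series_add apery_series_diff add_0_right
  proof (intro arg_cong[of _ _ apery_series] ext, goal_cases)
    case (1 n k)
    show ?case
      unfolding moment_relation_def telescoper_def u_def v_def theta_simps theta_X_power of_nat_Suc
        of_nat_numeral
      by algebra
  qed
  then show ?thesis
    by (simp add: apery_series_telescoper apery_series_moment_relation)
qed

section \<open>The hypergeometric series of the right-hand side\<close>

definition hyp_coeff :: "nat \<Rightarrow> nat" where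
  "hyp_coeff n = (3 * n choose n) * (2 * n choose n)\<^sup>2"

lemma of_nat_hyp_coeff:
  "of_nat (hyp_coeff n) = (fact (3 * n) * fact (2 * n) / fact n ^ 5 :: 'a::field_char_0)"
  by (simp add: hyp_coeff_def binomial_fact power2_eq_square eval_nat_numeral)

lemma hyp_coeff_Suc:
  "hyp_coeff (Suc n) * Suc n ^ 3 = 6 * ((3 * n + 1) * (3 * n + 2) * (2 * n + 1)) * hyp_coeff n"
proof -
  have times_Suc: "3 * Suc n = Suc (Suc (Suc (3 * n)))" "2 * Suc n = Suc (Suc (2 * n))"
    by simp_all
  have "of_nat (hyp_coeff (Suc n)) * of_nat (Suc n) ^ 3 =
      (6 * ((3 * of_nat n + 1) * (3 * of_nat n + 2) * (2 * of_nat n + 1)) *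
        of_nat (hyp_coeff n) :: rat)"
    unfolding of_nat_hyp_coeff times_Suc
    by (simp add: divide_simps del: of_nat_Suc) (simp add: algebra_simps eval_nat_numeral)
  also have "\<dots> = of_nat (6 * ((3 * n + 1) * (3 * n + 2) * (2 * n + 1)) * hyp_coeff n)"
    by (simp only: of_nat_mult of_nat_add of_nat_numeral of_nat_1)
  finally show ?thesis
    by (simp only: of_nat_mult[symmetric] of_nat_power[symmetric] of_nat_eq_iff)
qed

definition hyp_series :: "(nat \<Rightarrow> complex fps) \<Rightarrow> complex fps" where
  "hyp_series w =
    (\<Sum>n. (of_nat (hyp_coeff n) * w n) * (fps_X\<^sup>2 * inverse (1 - 4 * fps_X) ^ 3) ^ n)"

lemma hyp_series_nth_0: "fps_nth (hyp_series w) 0 = fps_nth (w 0) 0"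
  by (simp add: hyp_series_def fps_nth_suminf_mult_power hyp_coeff_def)

lemma hyp_series_add: "hyp_series v + hyp_series w = hyp_series (\<lambda>n. v n + w n)"
  by (simp add: hyp_series_def fps_suminf_mult_power_add distrib_left)

lemma hyp_series_mult: "c * hyp_series w = hyp_series (\<lambda>n. c * w n)"
  unfolding hyp_series_def by (subst fps_suminf_mult_power_cmult) (simp_all add: mult_ac)

lemma theta_hyp_series:
  "theta (hyp_series w) = hyp_series (\<lambda>n. theta (w n) + of_nat n * (2 + 4 * fps_X) * w n)"
proof -
  define t :: "complex fps" where "t = fps_X\<^sup>2 * inverse (1 - 4 * fps_X) ^ 3"
  have t: "fps_nth t 0 = 0" "theta t = (2 + 4 * fps_X) * t"
    unfolding t_def theta_simps theta_X_power theta_power_eigen[OF theta_inverse_one_minus_4X]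
      of_nat_numeral
    by (simp, algebra)
  show ?thesis
    unfolding hyp_series_def t_def[symmetric] theta_suminf_mult_power[OF t]
    by (simp add: algebra_simps)
qed

lemma hyp_series_Suc:
  "(1 - 4 * fps_X) ^ 3 * hyp_series (\<lambda>n. c * of_nat n ^ 3) = hyp_series
    (\<lambda>n. fps_X\<^sup>2 * (6 * c * ((3 * of_nat n + 1) * (3 * of_nat n + 2) * (2 * of_nat n + 1))))"
    (is "_ * hyp_series ?f = hyp_series (\<lambda>n. fps_X\<^sup>2 * ?g n)")
proof -
  let ?i = "inverse (1 - 4 * fps_X) :: complex fps"
  have shift: "of_nat (hyp_coeff (Suc n)) * ?f (Suc n) = of_nat (hyp_coeff n) * ?g n" for n
  proof -
    have "of_nat (hyp_coeff (Suc n)) * ?f (Suc n) = c * of_nat (hyp_coeff (Suc n) * Suc n ^ 3)"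
      by (simp only: of_nat_mult of_nat_power mult_ac)
    also have "\<dots> = of_nat (hyp_coeff n) * ?g n"
      unfolding hyp_coeff_Suc of_nat_mult of_nat_add of_nat_numeral of_nat_1 by (simp only: mult_ac)
    finally show ?thesis .
  qed
  have "hyp_series ?f = fps_X\<^sup>2 * ?i ^ 3 *
      (\<Sum>n. of_nat (hyp_coeff (Suc n)) * ?f (Suc n) * (fps_X\<^sup>2 * ?i ^ 3) ^ n)"
    unfolding hyp_series_def by (rule fps_suminf_mult_power_Suc) simp_all
  then have "hyp_series ?f = fps_X\<^sup>2 * ?i ^ 3 * hyp_series ?g"
    by (simp only: shift hyp_series_def)
  then have "(1 - 4 * fps_X) ^ 3 * hyp_series ?f =
      ((1 - 4 * fps_X) * ?i) ^ 3 * (fps_X\<^sup>2 * hyp_series ?g)"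
    by (simp only: power_mult_distrib mult_ac)
  then show ?thesis
    by (simp only: one_minus_4X_mult_inverse power_one mult_1 hyp_series_mult[of "fps_X\<^sup>2"])
qed

lemma hyp_series_recurrence:
  "hyp_series (\<lambda>n. (1 - 4 * fps_X) ^ 3 * (c * of_nat n ^ 3) -
    fps_X\<^sup>2 * (6 * c * ((3 * of_nat n + 1) * (3 * of_nat n + 2) * (2 * of_nat n + 1)))) = 0"
    (is "hyp_series (\<lambda>n. ?f n - ?g n) = 0")
proof -
  have "hyp_series (\<lambda>n. ?f n - ?g n) + hyp_series ?g = hyp_series ?f"
    by (simp add: hyp_series_add)
  then show ?thesis
    using hyp_series_Suc[of c] by (simp add: hyp_series_mult)
qed

definition inv_sqrt_fps :: "complex fps" where
  "inv_sqrt_fps = fps_expansion (\<lambda>x. 1 / csqrt (1 - 4 * x)) 0"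

lemma one_minus_4x_notin_nonpos_Reals:
  assumes "norm (x :: complex) < 1 / 4"
  shows "1 - 4 * x \<notin> \<real>\<^sub>\<le>\<^sub>0"
  using assms complex_Re_le_cmod[of x] by (auto simp: complex_nonpos_Reals_iff)

lemma one_minus_4x_neq_0:
  assumes "norm (x :: complex) < 1 / 4"
  shows "1 - 4 * x \<noteq> 0"
  using one_minus_4x_notin_nonpos_Reals[OF assms] by (metis nonpos_Reals_zero_I)

lemma inv_sqrt_fps_expansion: "(\<lambda>x. 1 / csqrt (1 - 4 * x)) has_fps_expansion inv_sqrt_fps"
proof -
  have "(\<lambda>x. 1 / csqrt (1 - 4 * x)) holomorphic_on ball 0 (1 / 4)"
    using one_minus_4x_notin_nonpos_Reals one_minus_4x_neq_0 by (intro holomorphic_intros) auto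
  then show ?thesis
    unfolding inv_sqrt_fps_def by (intro has_fps_expansion_fps_expansion) auto
qed

lemma inv_sqrt_fps_nth_0: "fps_nth inv_sqrt_fps 0 = 1"
  using has_fps_expansion_imp_0_eq_fps_nth_0[OF inv_sqrt_fps_expansion] by simp

lemma inv_sqrt_fps_square: "(1 - 4 * fps_X) * inv_sqrt_fps\<^sup>2 = 1"
proof (rule fps_expansion_unique_complex)
  show "(\<lambda>x. (1 - 4 * x) * (1 / csqrt (1 - 4 * x))\<^sup>2) has_fps_expansion
      (1 - 4 * fps_X) * inv_sqrt_fps\<^sup>2"
    by (intro fps_expansion_intros inv_sqrt_fps_expansion)
  have "\<forall>\<^sub>F x in nhds 0. x \<in> ball (0 :: complex) (1 / 4)"
    by (rule eventually_nhds_in_open) auto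
  then have "\<forall>\<^sub>F x :: complex in nhds 0. (1 - 4 * x) * (1 / csqrt (1 - 4 * x))\<^sup>2 = 1"
    by eventually_elim (use one_minus_4x_neq_0 in \<open>simp add: power_divide\<close>)
  then show "(\<lambda>x. (1 - 4 * x) * (1 / csqrt (1 - 4 * x))\<^sup>2) has_fps_expansion 1"
    by (subst has_fps_expansion_cong[OF _ refl, of _ "\<lambda>_. 1"]) auto
qed

lemma theta_inv_sqrt_fps: "theta inv_sqrt_fps = 2 * fps_X * inv_sqrt_fps"
proof -
  have "2 * ((1 - 4 * fps_X) * inv_sqrt_fps * theta inv_sqrt_fps) =
      4 * fps_X * ((1 - 4 * fps_X) * inv_sqrt_fps\<^sup>2)"
    using arg_cong[OF inv_sqrt_fps_square, of theta]
    by (simp add: power2_eq_square algebra_simps)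
  then have "2 * theta inv_sqrt_fps = 2 * (2 * fps_X * inv_sqrt_fps)"
    using inv_sqrt_fps_square by algebra
  then show ?thesis by (metis mult_left_cancel zero_neq_numeral)
qed

lemma theta_op_ode_hyp_series: "theta_op ode_coeffs (hyp_series (\<lambda>n. inv_sqrt_fps)) = 0"
proof -
  define c where "c = 8 * (1 + 2 * fps_X) * inv_sqrt_fps"
  have "theta_op ode_coeffs (hyp_series (\<lambda>n. inv_sqrt_fps)) =
      hyp_series (\<lambda>n. (1 - 4 * fps_X) ^ 3 * (c * of_nat n ^ 3) -
        fps_X\<^sup>2 * (6 * c * ((3 * of_nat n + 1) * (3 * of_nat n + 2) * (2 * of_nat n + 1))))"
    unfolding ode_coeffs_def theta_op.simps theta_hyp_series hyp_series_mult hyp_series_add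
      add_0_right
  proof (intro arg_cong[of _ _ hyp_series] ext, goal_cases)
    case (1 n)
    show ?case
      unfolding c_def theta_simps theta_inv_sqrt_fps by algebra
  qed
  then show ?thesis
    by (simp only: hyp_series_recurrence)
qed

lemma apery_series_1_eq: "apery_series (\<lambda>n k. 1) = inv_sqrt_fps * hyp_series (\<lambda>n. 1)"
proof -
  have "apery_series (\<lambda>n k. 1) - hyp_series (\<lambda>n. inv_sqrt_fps) = 0"
  proof (rule theta_op_eq_0_imp_eq_0[where r = 1 and ps = ode_coeffs])
    show "theta_op ode_coeffs (apery_series (\<lambda>n k. 1) - hyp_series (\<lambda>n. inv_sqrt_fps)) = 0"
      by (simp add: theta_op_diff theta_op_ode_apery_series theta_op_ode_hyp_series)
  qed (auto simp: ode_coeffs_def apery_series_nth_0 hyp_series_nth_0 inv_sqrt_fps_nth_0)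
  then show ?thesis
    by (simp add: hyp_series_mult)
qed

lemma apery_series_n_eq:
  "3 * (1 - 4 * fps_X + 8 * fps_X\<^sup>2) * apery_series (\<lambda>n k. of_nat n) =
    inv_sqrt_fps * (4 * (1 + 2 * fps_X) * (1 - fps_X) * hyp_series of_nat +
      3 * (2 * fps_X * (1 - 2 * fps_X)) * hyp_series (\<lambda>n. 1))"
proof -
  define M K H :: "complex fps" where "M = apery_series (\<lambda>n k. of_nat n)"
    and "K = apery_series (\<lambda>n k. of_nat k)" and "H = inv_sqrt_fps * hyp_series (\<lambda>n. 1)"
  have "M + (1 - 4 * fps_X) * K = theta (apery_series (\<lambda>n k. 1))"
    unfolding M_def K_def theta_apery_series apery_series_mult apery_series_add
    by (simp add: mult_ac)
  also have "\<dots> = 2 * fps_X * H + inv_sqrt_fps * ((2 + 4 * fps_X) * hyp_series of_nat)"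
    unfolding apery_series_1_eq H_def theta_simps theta_inv_sqrt_fps theta_hyp_series
      hyp_series_mult[of "2 + 4 * fps_X"]
    by (simp add: mult_ac)
  finally have theta_eq:
    "M + (1 - 4 * fps_X) * K =
      2 * fps_X * H + inv_sqrt_fps * ((2 + 4 * fps_X) * hyp_series of_nat)" .
  have "(1 - 6 * fps_X) * M - 2 * (1 - fps_X) * K - 2 * fps_X * H = apery_series moment_relation"
    unfolding M_def K_def H_def apery_series_1_eq[symmetric] apery_series_mult apery_series_diff
    by (simp add: moment_relation_def[abs_def])
  then have "(1 - 6 * fps_X) * M - 2 * (1 - fps_X) * K - 2 * fps_X * H = 0"
    by (simp only: apery_series_moment_relation)
  with theta_eq show ?thesis
    unfolding M_def[symmetric] using H_def by algebra
qed

section \<open>Analytic expansions of the moments\<close>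

definition apery_moment_term :: "nat \<Rightarrow> nat \<Rightarrow> complex \<Rightarrow> complex" where
  "apery_moment_term i n x =
    (\<Sum>k\<le>n. of_nat (apery_coeff n k) * of_nat n ^ i * x ^ k) * (x / (1 - 4 * x)) ^ n"

definition apery_moment :: "nat \<Rightarrow> complex \<Rightarrow> complex" where
  "apery_moment i x = (\<Sum>n. apery_moment_term i n x)"

definition hyp_moment_term :: "nat \<Rightarrow> nat \<Rightarrow> complex \<Rightarrow> complex" where
  "hyp_moment_term i n x = of_nat (hyp_coeff n) * of_nat n ^ i * (x\<^sup>2 / (1 - 4 * x) ^ 3) ^ n"

definition hyp_moment :: "nat \<Rightarrow> complex \<Rightarrow> complex" where
  "hyp_moment i x = (\<Sum>n. hyp_moment_term i n x)"

lemma apery_coeff_le: "k \<le> n \<Longrightarrow> apery_coeff n k \<le> 64 ^ n"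
proof -
  assume "k \<le> n"
  then have "(2 :: nat) ^ (n + k) \<le> 2 ^ (2 * n)"
    by (intro power_increasing) auto
  then have "n + k choose k \<le> 2 ^ (2 * n)"
    using binomial_le_pow2 order_trans by blast
  then have "apery_coeff n k \<le> 2 ^ (2 * n) * (2 ^ n)\<^sup>2 * 2 ^ (2 * n)"
    unfolding apery_coeff_def by (intro mult_mono power_mono binomial_le_pow2) auto
  also have "\<dots> = 64 ^ n"
    by (simp add: power_mult power2_eq_square flip: power_mult_distrib)
  finally show ?thesis .
qed

lemma hyp_coeff_le: "hyp_coeff n \<le> 128 ^ n"
proof -
  have "hyp_coeff n \<le> 2 ^ (3 * n) * (2 ^ (2 * n))\<^sup>2"
    unfolding hyp_coeff_def by (intro mult_mono power_mono binomial_le_pow2) auto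
  also have "\<dots> = 128 ^ n"
    by (simp add: power_mult power2_eq_square flip: power_mult_distrib)
  finally show ?thesis .
qed

lemma real_power_le_two_power_power: "real n ^ i \<le> (2 ^ i) ^ n"
proof -
  have "real n ^ i \<le> (2 ^ n) ^ i"
    using less_imp_le[OF of_nat_less_two_power[of n]] by (intro power_mono) auto
  then show ?thesis
    by (metis mult.commute power_mult)
qed

lemma norm_apery_sum_le:
  assumes "norm x \<le> 1"
  shows "norm (\<Sum>k\<le>n. of_nat (apery_coeff n k) * of_nat n ^ i * x ^ k :: complex)
    \<le> (2 * (64 * 2 ^ i)) ^ n"
proof -
  have "norm (of_nat (apery_coeff n k) * of_nat n ^ i * x ^ k :: complex)
      \<le> 64 ^ n * (2 ^ i) ^ n * 1"
    if "k \<in> {..n}" for k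
  proof -
    have "real (apery_coeff n k) \<le> 64 ^ n"
      using that of_nat_mono[OF apery_coeff_le[of k n], where 'a = real] by simp
    then show ?thesis
      unfolding norm_mult norm_power norm_of_nat using assms
      by (intro mult_mono real_power_le_two_power_power power_le_one) auto
  qed
  then have "norm (\<Sum>k\<le>n. of_nat (apery_coeff n k) * of_nat n ^ i * x ^ k :: complex) \<le>
      (\<Sum>k\<le>n. 64 ^ n * (2 ^ i) ^ n * 1)"
    by (rule sum_norm_le)
  also have "\<dots> = real (Suc n) * (64 ^ n * (2 ^ i) ^ n)"
    by simp
  also have "\<dots> \<le> 2 ^ n * (64 ^ n * (2 ^ i) ^ n)"
    using of_nat_mono[OF Suc_leI[OF less_exp[of n]], where 'a = real]
    by (intro mult_right_mono) auto
  also have "\<dots> = (2 * (64 * 2 ^ i)) ^ n"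
    by (simp only: power_mult_distrib)
  finally show ?thesis .
qed

lemma apery_moment_has_fps_expansion:
  "apery_moment i has_fps_expansion apery_series (\<lambda>n k. of_nat n ^ i)"
  and eventually_sums_apery_moment:
    "\<forall>\<^sub>F x in nhds 0. (\<lambda>n. apery_moment_term i n x) sums apery_moment i x"
proof -
  define p where "p n x = (\<Sum>k\<le>n. of_nat (apery_coeff n k) * of_nat n ^ i * x ^ k :: complex)"
    for n x
  have ball: "open (ball 0 (1 / 4) :: complex set)" "(0 :: complex) \<in> ball 0 (1 / 4)"
    by simp_all
  have p_holomorphic: "p n holomorphic_on ball 0 (1 / 4)" for n
    unfolding p_def[abs_def] by (intro holomorphic_intros)
  have y_holomorphic: "(\<lambda>x. x / (1 - 4 * x)) holomorphic_on ball 0 (1 / 4)"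
    using one_minus_4x_neq_0 by (intro holomorphic_intros) auto
  have p_bound: "norm (p n x) \<le> (2 * (64 * 2 ^ i)) ^ n" if "x \<in> ball 0 (1 / 4)" for n x
    unfolding p_def using that by (intro norm_apery_sum_le) simp
  have p_expansion: "p n has_fps_expansion apery_poly (\<lambda>n k. of_nat n ^ i) n" for n
    unfolding p_def[abs_def] apery_poly_def fps_of_nat[symmetric] by (intro fps_expansion_intros)
  have y_expansion: "(\<lambda>x. x / (1 - 4 * x)) has_fps_expansion
      fps_X * inverse (1 - 4 * fps_X :: complex fps)"
    unfolding divide_inverse by (intro fps_expansion_intros) simp
  note expansion_hyps = ball p_holomorphic y_holomorphic p_bound p_expansion y_expansion
  have "apery_moment i = (\<lambda>x. \<Sum>n. p n x * (x / (1 - 4 * x)) ^ n)"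
    by (simp add: fun_eq_iff apery_moment_def apery_moment_term_def p_def)
  then show "apery_moment i has_fps_expansion apery_series (\<lambda>n k. of_nat n ^ i)"
    using has_fps_expansion_suminf_mult_power[OF expansion_hyps] by (simp add: apery_series_def)
  have "\<forall>\<^sub>F x in nhds 0. summable (\<lambda>n. p n x * (x / (1 - 4 * x)) ^ n)"
    by (rule eventually_summable_mult_power[OF expansion_hyps]) simp_all
  then show "\<forall>\<^sub>F x in nhds 0. (\<lambda>n. apery_moment_term i n x) sums apery_moment i x"
    by eventually_elim (simp add: summable_sums apery_moment_def apery_moment_term_def p_def)
qed

lemma hyp_moment_has_fps_expansion:
  "hyp_moment i has_fps_expansion hyp_series (\<lambda>n. of_nat n ^ i)"
  and eventually_sums_hyp_moment:
    "\<forall>\<^sub>F x in nhds 0. (\<lambda>n. hyp_moment_term i n x) sums hyp_moment i x"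
proof -
  define p where "p n x = (of_nat (hyp_coeff n) * of_nat n ^ i :: complex)" for n and x :: complex
  have ball: "open (ball 0 (1 / 4) :: complex set)" "(0 :: complex) \<in> ball 0 (1 / 4)"
    by simp_all
  have p_holomorphic: "p n holomorphic_on ball 0 (1 / 4)" for n
    unfolding p_def[abs_def] by (intro holomorphic_intros)
  have t_holomorphic: "(\<lambda>x. x\<^sup>2 / (1 - 4 * x) ^ 3) holomorphic_on ball 0 (1 / 4)"
    using one_minus_4x_neq_0 by (intro holomorphic_intros) auto
  have p_bound: "norm (p n x) \<le> (128 * 2 ^ i) ^ n" for n x
  proof -
    have "real (hyp_coeff n) \<le> 128 ^ n"
      using of_nat_mono[OF hyp_coeff_le[of n], where 'a = real] by simp
    then show ?thesis
      unfolding p_def norm_mult norm_power norm_of_nat power_mult_distrib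
      by (intro mult_mono real_power_le_two_power_power) auto
  qed
  have p_expansion: "p n has_fps_expansion of_nat (hyp_coeff n) * of_nat n ^ i" for n
    unfolding p_def[abs_def] fps_of_nat[symmetric] by (intro fps_expansion_intros)
  have t_expansion: "(\<lambda>x. x\<^sup>2 / (1 - 4 * x) ^ 3) has_fps_expansion
      fps_X\<^sup>2 * inverse (1 - 4 * fps_X :: complex fps) ^ 3"
    unfolding divide_inverse power_inverse[symmetric] by (intro fps_expansion_intros) simp
  note expansion_hyps = ball p_holomorphic t_holomorphic p_bound p_expansion t_expansion
  have "hyp_moment i = (\<lambda>x. \<Sum>n. p n x * (x\<^sup>2 / (1 - 4 * x) ^ 3) ^ n)"
    by (simp add: fun_eq_iff hyp_moment_def hyp_moment_term_def p_def)
  then show "hyp_moment i has_fps_expansion hyp_series (\<lambda>n. of_nat n ^ i)"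
    using has_fps_expansion_suminf_mult_power[OF expansion_hyps] by (simp add: hyp_series_def)
  have "\<forall>\<^sub>F x in nhds 0. summable (\<lambda>n. p n x * (x\<^sup>2 / (1 - 4 * x) ^ 3) ^ n)"
    by (rule eventually_summable_mult_power[OF expansion_hyps]) simp_all
  then show "\<forall>\<^sub>F x in nhds 0. (\<lambda>n. hyp_moment_term i n x) sums hyp_moment i x"
    by eventually_elim (simp add: summable_sums hyp_moment_def hyp_moment_term_def p_def)
qed

lemma eventually_apery_moment_0_eq:
  "\<forall>\<^sub>F x in nhds 0. apery_moment 0 x = 1 / csqrt (1 - 4 * x) * hyp_moment 0 x"
proof (rule has_fps_expansion_eventually_eq)
  show "apery_moment 0 has_fps_expansion apery_series (\<lambda>n k. 1)"
    using apery_moment_has_fps_expansion[of 0] by simp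
  show "(\<lambda>x. 1 / csqrt (1 - 4 * x) * hyp_moment 0 x) has_fps_expansion apery_series (\<lambda>n k. 1)"
    using hyp_moment_has_fps_expansion[of 0] unfolding apery_series_1_eq
    by (intro fps_expansion_intros inv_sqrt_fps_expansion) simp
qed

lemma eventually_apery_moment_1_eq:
  "\<forall>\<^sub>F x in nhds 0. 3 * (1 - 4 * x + 8 * x\<^sup>2) * apery_moment 1 x =
    1 / csqrt (1 - 4 * x) * (4 * (1 + 2 * x) * (1 - x) * hyp_moment 1 x +
      3 * (2 * x * (1 - 2 * x)) * hyp_moment 0 x)"
proof (rule has_fps_expansion_eventually_eq)
  show "(\<lambda>x. 3 * (1 - 4 * x + 8 * x\<^sup>2) * apery_moment 1 x) has_fps_expansion
      3 * (1 - 4 * fps_X + 8 * fps_X\<^sup>2) * apery_series (\<lambda>n k. of_nat n)"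
    using apery_moment_has_fps_expansion[of 1] by (intro fps_expansion_intros) simp
  show "(\<lambda>x. 1 / csqrt (1 - 4 * x) * (4 * (1 + 2 * x) * (1 - x) * hyp_moment 1 x +
      3 * (2 * x * (1 - 2 * x)) * hyp_moment 0 x)) has_fps_expansion
      3 * (1 - 4 * fps_X + 8 * fps_X\<^sup>2) * apery_series (\<lambda>n k. of_nat n)"
    using hyp_moment_has_fps_expansion[of 0] hyp_moment_has_fps_expansion[of 1]
    unfolding apery_series_n_eq by (intro fps_expansion_intros inv_sqrt_fps_expansion) simp_all
qed

lemma sums_apery_moments:
  assumes "(\<lambda>n. apery_moment_term 1 n x) sums M1" "(\<lambda>n. apery_moment_term 0 n x) sums M0"
  shows "(\<lambda>n. of_nat ((2 * n) choose n) * (a * of_nat n + b) * (x ^ n / (1 - 4 * x) ^ n) *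
      (\<Sum>k = 0..n. of_nat ((n choose k) ^ 2 * ((n + k) choose k)) * x ^ k)) sums (a * M1 + b * M0)"
proof -
  have "of_nat ((2 * n) choose n) * (a * of_nat n + b) * (x ^ n / (1 - 4 * x) ^ n) *
      (\<Sum>k = 0..n. of_nat ((n choose k) ^ 2 * ((n + k) choose k)) * x ^ k) =
    a * apery_moment_term 1 n x + b * apery_moment_term 0 n x" for n
    unfolding apery_moment_term_def apery_coeff_def atLeast0AtMost sum_distrib_left
      sum_distrib_right sum.distrib[symmetric]
    by (intro sum.cong) (simp_all add: power_divide algebra_simps)
  then show ?thesis
    using assms by (simp only:) (intro sums_add sums_mult)
qed

lemma sums_hyp_moments:
  assumes "(\<lambda>n. hyp_moment_term 1 n x) sums M1" "(\<lambda>n. hyp_moment_term 0 n x) sums M0"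
  shows "(\<lambda>n. of_nat (((3 * n) choose n) * ((2 * n) choose n) ^ 2) * (A * of_nat n + B) *
      (x ^ (2 * n) / (1 - 4 * x) ^ (3 * n))) sums (A * M1 + B * M0)"
proof -
  have "of_nat (((3 * n) choose n) * ((2 * n) choose n) ^ 2) * (A * of_nat n + B) *
      (x ^ (2 * n) / (1 - 4 * x) ^ (3 * n)) =
    A * hyp_moment_term 1 n x + B * hyp_moment_term 0 n x" for n
    unfolding hyp_moment_term_def hyp_coeff_def power_divide power_mult[symmetric]
    by (simp add: algebra_simps)
  then show ?thesis
    using assms by (simp only:) (intro sums_add sums_mult)
qed

lemma moment_combination_eq:
  fixes q s x :: "'a::field_char_0"
  assumes "q \<noteq> 0" "M0 = 1 / s * H0"
    and "3 * q * M1 = 1 / s * (4 * (1 + 2 * x) * (1 - x) * H1 + 3 * (2 * x * (1 - 2 * x)) * H0)"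
  shows "a * M1 + b * M0 =
    4 * a * (1 + 2 * x) * (1 - x) / (3 * q * s) * H1 +
      1 / s * (2 * a * x * (1 - 2 * x) / q + b) * H0"
proof -
  have M1: "M1 =
      1 / s * (4 * (1 + 2 * x) * (1 - x) * H1 + 3 * (2 * x * (1 - 2 * x)) * H0) / (3 * q)"
    using \<open>q \<noteq> 0\<close> unfolding assms(3)[symmetric] by simp
  show ?thesis
    unfolding M1 assms(2) using \<open>q \<noteq> 0\<close> by (cases "s = 0") (simp_all add: field_simps)
qed

theorem theorem5p2:
  fixes a b :: complex
  shows "\<forall>\<^sub>F x :: complex in nhds 0.
    (let A = 4 * a * (1 + 2 * x) * (1 - x) / (3 * (1 - 4 * x + 8 * x ^ 2) * csqrt (1 - 4 * x));
         B = 1 / csqrt (1 - 4 * x) * (2 * a * x * (1 - 2 * x) / (1 - 4 * x + 8 * x ^ 2) + b);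
         f = (\<lambda>n. of_nat ((2 * n) choose n) * (a * of_nat n + b) * (x ^ n / (1 - 4 * x) ^ n) *
               (\<Sum>k = 0..n. of_nat ((n choose k) ^ 2 * ((n + k) choose k)) * x ^ k));
         g = (\<lambda>n. of_nat (((3 * n) choose n) * ((2 * n) choose n) ^ 2) * (A * of_nat n + B) *
               (x ^ (2 * n) / (1 - 4 * x) ^ (3 * n)))
     in summable f \<and> summable g \<and> (\<Sum>n. f n) = (\<Sum>n. g n))"
proof -
  have "((\<lambda>x :: complex. 1 - 4 * x + 8 * x ^ 2) \<longlongrightarrow> 1 - 4 * 0 + 8 * 0 ^ 2) (nhds 0)"
    by (intro tendsto_intros filterlim_ident)
  then have "\<forall>\<^sub>F x :: complex in nhds 0. 1 - 4 * x + 8 * x ^ 2 \<noteq> 0"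
    by (rule tendsto_imp_eventually_ne) simp
  then show ?thesis
    using eventually_apery_moment_0_eq eventually_apery_moment_1_eq
      eventually_sums_apery_moment[of 0] eventually_sums_apery_moment[of 1]
      eventually_sums_hyp_moment[of 0] eventually_sums_hyp_moment[of 1]
  proof eventually_elim
    case (elim x)
    note lhs = sums_apery_moments[OF elim(5,4), of a b]
    note rhs = sums_hyp_moments[OF elim(7,6)]
    show ?case
      unfolding Let_def using sums_summable[OF lhs] sums_summable[OF rhs] sums_unique[OF lhs]
        sums_unique[OF rhs] moment_combination_eq[OF elim(1,2,3)] by metis
  qed
qed

end
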